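(* Let $q$ be a prime power and $n,m,k$ positive integers with $m<n\le km$. Let $t=\lfloor (km-n)/m\rfloor$, $a=n-(k-t-2)m$ and $h=\max\{\lfloor a/2^{t+1}\rfloor,1\}$. Then $L_{\mathrm{rk}}(n,m,k,q)\le m-h+1$.
   Context: $\mathbb{F}_{q^m}$ is the degree-$m$ extension of $\mathbb{F}_q$. Rank weight of $\mathbf v=(v_1,\dots,v_n)\in\mathbb{F}_{q^m}^n$: $\mathrm{w}(\mathbf v)=\dim_{\mathbb{F}_q}\langle v_1,\dots,v_n\rangle_{\mathbb{F}_q}$. An $[n,k]_{q^m/q}$ code is a $k$-dimensional $\mathbb{F}_{q^m}$-subspace $\mathcal C\subseteq\mathbb{F}_{q^m}^n$; it is nondegenerate if the $\mathbb{F}_q$-span of the columns of a generator matrix (a $k\times n$ matrix whose rows span $\mathcal C$) has $\mathbb{F}_q$-dimension $n$. $\mathrm{WS}(\mathcal C)=\{\mathrm{w}(\mathbf c):\mathbf c\in\mathcal C\setminus\{\mathbf 0\}\}$. $L_{\mathrm{rk}}(n,m,k,q)$ is the maximum of $|\mathrm{WS}(\mathcal C)|$ over all nondegenerate $[n,k]_{q^m/q}$ codes. *)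

theory Defs
  imports Complex_Main "HOL-Library.Function_Algebras" "HOL-Number_Theory.Prime_Powers"
begin

text \<open>
  The extension \<open>\<bbbF>\<^sub>q \<subseteq> \<bbbF>\<^bsub>q^m\<^esub>\<close> is given by two finite field types \<open>'f\<close> and \<open>'e\<close> and an
  embedding \<open>\<iota> :: 'f \<Rightarrow> 'e\<close>, through which \<open>'e\<close> and the spaces of vectors over \<open>'e\<close> become
  vector spaces over \<open>'f\<close>.
  Vectors of length \<open>n\<close> are functions on \<open>nat\<close> vanishing outside \<open>{..<n}\<close>, and a \<open>k \<times> n\<close> matrix
  \<open>G\<close> has entries \<open>G i j\<close>, vanishing unless \<open>i < k\<close> and \<open>j < n\<close>; so \<open>G i\<close> is its \<open>i\<close>-th row and
  \<open>\<lambda>i. G i j\<close> its \<open>j\<close>-th column.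
\<close>

definition field_embedding :: "('f::field \<Rightarrow> 'e::field) \<Rightarrow> bool" where
  "field_embedding \<iota> \<longleftrightarrow> \<iota> 1 = 1 \<and> (\<forall>x y. \<iota> (x + y) = \<iota> x + \<iota> y) \<and> (\<forall>x y. \<iota> (x * y) = \<iota> x * \<iota> y)"

definition sub_scale :: "('f::field \<Rightarrow> 'e::field) \<Rightarrow> 'f \<Rightarrow> 'e \<Rightarrow> 'e" where
  "sub_scale \<iota> c x = \<iota> c * x"

definition sub_vscale :: "('f::field \<Rightarrow> 'e::field) \<Rightarrow> 'f \<Rightarrow> (nat \<Rightarrow> 'e) \<Rightarrow> (nat \<Rightarrow> 'e)" where
  "sub_vscale \<iota> c v = (\<lambda>i. \<iota> c * v i)"

definition ext_vscale :: "'e::field \<Rightarrow> (nat \<Rightarrow> 'e) \<Rightarrow> (nat \<Rightarrow> 'e)" where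
  "ext_vscale c v = (\<lambda>i. c * v i)"

lemma vector_space_sub_scale: "field_embedding \<iota> \<Longrightarrow> vector_space (sub_scale \<iota>)"
  by unfold_locales (auto simp: field_embedding_def sub_scale_def algebra_simps)

lemma vector_space_sub_vscale: "field_embedding \<iota> \<Longrightarrow> vector_space (sub_vscale \<iota>)"
  by unfold_locales (auto simp: field_embedding_def sub_vscale_def algebra_simps fun_eq_iff)

lemma vector_space_ext_vscale: "vector_space ext_vscale"
  by unfold_locales (auto simp: ext_vscale_def algebra_simps fun_eq_iff)

definition finite_field_extension ::
    "('f::{field,finite} \<Rightarrow> 'e::{field,finite}) \<Rightarrow> nat \<Rightarrow> nat \<Rightarrow> bool" where
  "finite_field_extension \<iota> q m \<longleftrightarrow>
     field_embedding \<iota> \<and> card (UNIV :: 'f set) = q \<and>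
     vector_space.dim (sub_scale \<iota>) (UNIV :: 'e set) = m"

definition rank_weight :: "('f::field \<Rightarrow> 'e::field) \<Rightarrow> nat \<Rightarrow> (nat \<Rightarrow> 'e) \<Rightarrow> nat" where
  "rank_weight \<iota> n v =
     vector_space.dim (sub_scale \<iota>) (module.span (sub_scale \<iota>) (v ` {..<n}))"

definition is_code :: "nat \<Rightarrow> nat \<Rightarrow> (nat \<Rightarrow> 'e::field) set \<Rightarrow> bool" where
  "is_code n k C \<longleftrightarrow>
     (\<forall>v\<in>C. \<forall>i\<ge>n. v i = 0) \<and>
     module.subspace ext_vscale C \<and> vector_space.dim ext_vscale C = k"

definition generator_matrix ::
    "nat \<Rightarrow> nat \<Rightarrow> (nat \<Rightarrow> 'e::field) set \<Rightarrow> (nat \<Rightarrow> nat \<Rightarrow> 'e) \<Rightarrow> bool" where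
  "generator_matrix n k C G \<longleftrightarrow>
     (\<forall>i j. k \<le> i \<or> n \<le> j \<longrightarrow> G i j = 0) \<and> module.span ext_vscale (G ` {..<k}) = C"

definition nondegenerate ::
    "('f::field \<Rightarrow> 'e::field) \<Rightarrow> nat \<Rightarrow> nat \<Rightarrow> (nat \<Rightarrow> 'e) set \<Rightarrow> bool" where
  "nondegenerate \<iota> n k C \<longleftrightarrow>
     (\<exists>G. generator_matrix n k C G \<and>
        vector_space.dim (sub_vscale \<iota>)
          (module.span (sub_vscale \<iota>) ((\<lambda>j i. G i j) ` {..<n})) = n)"

definition weight_set :: "('f::field \<Rightarrow> 'e::field) \<Rightarrow> nat \<Rightarrow> (nat \<Rightarrow> 'e) set \<Rightarrow> nat set" where
  "weight_set \<iota> n C = rank_weight \<iota> n ` (C - {0})"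

text \<open>
  The parameters \<open>q\<close> and \<open>m\<close> are determined by \<open>\<iota>\<close>. On \<open>nat\<close>, \<open>Sup\<close> is the maximum of a nonempty
  finite set and \<open>0\<close> for the empty set; the latter occurs here only when there is no nondegenerate
  code with the given parameters, e.g. for \<open>n < k\<close>.
\<close>

definition L_rk :: "('f::{field,finite} \<Rightarrow> 'e::{field,finite}) \<Rightarrow> nat \<Rightarrow> nat \<Rightarrow> nat" where
  "L_rk \<iota> n k = Sup {card (weight_set \<iota> n C) | C. is_code n k C \<and> nondegenerate \<iota> n k C}"

end

theory Submission
  imports Defs "HOL-Library.FuncSet"
begin

text \<open>
  Choose codewords \<open>v\<^sub>0, v\<^sub>1, \<dots>, v\<^bsub>k-1\<^esub>\<close> greedily: \<open>v\<^sub>i\<close> has the least rank weight \<open>w\<^sub>i\<close> among the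
  codewords outside the span of its predecessors. Put \<open>S\<^sub>i = w\<^sub>0 + \<dots> + w\<^bsub>i-1\<^esub>\<close>. A codeword in the span
  of \<open>v\<^sub>0, \<dots>, v\<^bsub>i-1\<^esub>\<close> has weight at most \<open>S\<^sub>i\<close>, every other one has weight at least \<open>w\<^sub>i\<close>, so no
  weight lies strictly between \<open>S\<^sub>i\<close> and \<open>w\<^sub>i\<close>. If these gaps are small then \<open>S\<^sub>i\<close> at most roughly doubles
  at each step. On the other hand nondegeneracy gives \<open>S\<^sub>k \<ge> n\<close>, and since all weights are at most
  \<open>m\<close>, \<open>S\<^bsub>t+2\<^esub> \<ge> a\<close>. Hence the gaps contain at least \<open>h - 1\<close> of the values \<open>1, \<dots>, m\<close>.
\<close>

section \<open>Counting vectors in spans over finite fields\<close>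

lemma (in module) span_image_eq_sums:
  assumes "finite I"
  shows "span (f ` I) = (\<lambda>c. \<Sum>i\<in>I. c i *s f i) ` (I \<rightarrow>\<^sub>E UNIV)"
proof
  show "(\<lambda>c. \<Sum>i\<in>I. c i *s f i) ` (I \<rightarrow>\<^sub>E UNIV) \<subseteq> span (f ` I)"
    by (rule image_subsetI) (intro span_sum span_scale span_base imageI)
next
  show "span (f ` I) \<subseteq> (\<lambda>c. \<Sum>i\<in>I. c i *s f i) ` (I \<rightarrow>\<^sub>E UNIV)"
  proof
    fix x assume "x \<in> span (f ` I)"
    then have "\<exists>c. x = (\<Sum>i\<in>I. c i *s f i)"
    proof (induction rule: span_induct_alt)
      case base
      show ?case by (rule exI[of _ "\<lambda>_. 0"]) simp
    next
      case (step d y z)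
      then obtain c j where c: "z = (\<Sum>i\<in>I. c i *s f i)" and j: "j \<in> I" "y = f j" by auto
      have "(\<Sum>i\<in>I. (c i + (if i = j then d else 0)) *s f i) =
          (\<Sum>i\<in>I. c i *s f i) + (\<Sum>i\<in>I. if i = j then d *s f i else 0)"
        by (auto simp: scale_left_distrib sum.distrib[symmetric] intro!: sum.cong)
      also have "\<dots> = d *s y + z" using assms j c by (simp add: sum.delta)
      finally show ?case by metis
    qed
    then obtain c where "x = (\<Sum>i\<in>I. c i *s f i)" by blast
    then show "x \<in> (\<lambda>c. \<Sum>i\<in>I. c i *s f i) ` (I \<rightarrow>\<^sub>E UNIV)"
      by (intro image_eqI[of _ _ "restrict c I"]) (auto intro!: sum.cong)
  qed
qed

text \<open>Coefficient tuples over a basis determine vectors uniquely. This lets rank weights be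
  compared through cardinalities.\<close>

lemma (in vector_space) card_span:
  assumes "finite (UNIV :: 'a set)" "finite S"
  shows "card (span S) = card (UNIV :: 'a set) ^ dim S"
proof -
  obtain B where B: "B \<subseteq> S" "independent B" "S \<subseteq> span B" "card B = dim S"
    using basis_exists by blast
  have fin: "finite B" using B(1) assms(2) finite_subset by blast
  have span: "span S = span B"
    using B(1,3) by (simp add: span_eq span_base subset_eq)
  have "inj_on (\<lambda>c. \<Sum>b\<in>B. c b *s b) (B \<rightarrow>\<^sub>E UNIV)"
  proof (rule inj_onI)
    fix c d assume cd: "c \<in> B \<rightarrow>\<^sub>E UNIV" "d \<in> B \<rightarrow>\<^sub>E UNIV"
      and eq: "(\<Sum>b\<in>B. c b *s b) = (\<Sum>b\<in>B. d b *s b)"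
    have "(\<Sum>b\<in>B. (c b - d b) *s b) = 0"
      using eq by (simp add: scale_left_diff_distrib sum_subtractf)
    then have "c b - d b = 0" if "b \<in> B" for b
      using independentD[OF B(2) fin subset_refl, of "\<lambda>b. c b - d b"] that by blast
    then show "c = d" using cd by (auto intro: PiE_ext)
  qed
  then have "card (span B) = card (B \<rightarrow>\<^sub>E (UNIV :: 'a set))"
    using span_image_eq_sums[OF fin, of "\<lambda>b. b"] by (simp add: card_image)
  also have "\<dots> = card (UNIV :: 'a set) ^ card B"
    using fin by (simp add: card_PiE)
  finally show ?thesis using span B(4) by simp
qed

text \<open>Extend \<open>B\<close> to a maximal independent subset of \<open>V\<close>; it has the
  same finite cardinality, so nothing was added.\<close>

lemma (in vector_space) basis_if_card_eq_dim:
  assumes "independent B" "B \<subseteq> V" "finite B" "card B = dim V" "finite V"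
  shows "V \<subseteq> span B"
proof -
  obtain B' where B': "B \<subseteq> B'" "B' \<subseteq> V" "independent B'" "V \<subseteq> span B'"
    using maximal_independent_subset_extend[OF assms(2,1)] by blast
  have "card B' = dim V" using B' by (intro basis_card_eq_dim)
  then have "B = B'"
    using B' assms by (intro card_subset_eq) (auto intro: finite_subset)
  then show ?thesis using B' by simp
qed

section \<open>Rank weight through counting base-field combinations of entries\<close>

definition sub_combs :: "('f::field \<Rightarrow> 'e::field) \<Rightarrow> nat \<Rightarrow> (nat \<Rightarrow> 'e) \<Rightarrow> 'e set" where
  "sub_combs \<iota> n v = (\<lambda>c. \<Sum>j<n. \<iota> (c j) * v j) ` ({..<n} \<rightarrow>\<^sub>E UNIV)"

lemma sub_combsI: "(\<Sum>j<n. \<iota> (c j) * v j) \<in> sub_combs \<iota> n v"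
  unfolding sub_combs_def
  by (rule image_eqI[of _ _ "restrict c {..<n}"]) (auto intro!: sum.cong)

lemma sub_combsE:
  assumes "x \<in> sub_combs \<iota> n v"
  obtains c where "x = (\<Sum>j<n. \<iota> (c j) * v j)"
  using assms unfolding sub_combs_def by blast

context
  fixes \<iota> :: "'f::{field,finite} \<Rightarrow> 'e::{field,finite}" and q m :: nat
  assumes ext: "finite_field_extension \<iota> q m"
begin

lemma embedding: "field_embedding \<iota>"
  using ext by (simp add: finite_field_extension_def)

lemma base_card: "card (UNIV :: 'f set) = q"
  using ext by (simp add: finite_field_extension_def)

interpretation sub: vector_space "sub_scale \<iota>"
  by (rule vector_space_sub_scale[OF embedding])

interpretation subv: vector_space "sub_vscale \<iota>"
  by (rule vector_space_sub_vscale[OF embedding])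

interpretation extv: vector_space "ext_vscale :: 'e \<Rightarrow> _"
  by (rule vector_space_ext_vscale)

lemma embed_0: "\<iota> 0 = 0"
  using embedding unfolding field_embedding_def by (metis add_cancel_right_right)

lemma embed_1: "\<iota> 1 = 1"
  using embedding unfolding field_embedding_def by blast

lemma one_less_q: "1 < q"
proof -
  have "card {0, 1 :: 'f} \<le> card (UNIV :: 'f set)" by (intro card_mono) auto
  then show ?thesis using base_card by simp
qed

text \<open>\<open>sub_combs\<close> is the base-field span of the entries of \<open>v\<close>, so
  its size determines the weight. Bounds on weights then follow by covering these finite sets or
  mapping injectively into them.\<close>

lemma card_sub_combs: "card (sub_combs \<iota> n v) = q ^ rank_weight \<iota> n v"
proof -
  have "sub_combs \<iota> n v = sub.span (v ` {..<n})"
    by (simp add: sub.span_image_eq_sums sub_combs_def sub_scale_def)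
  then show ?thesis
    by (simp add: sub.card_span base_card rank_weight_def)
qed

lemma rank_weight_leI: "card (sub_combs \<iota> n v) \<le> q ^ r \<Longrightarrow> rank_weight \<iota> n v \<le> r"
  using one_less_q by (simp add: card_sub_combs)

lemma rank_weight_le_degree: "rank_weight \<iota> n v \<le> m"
proof (rule rank_weight_leI)
  have "card (UNIV :: 'e set) = q ^ m"
    using sub.card_span[of UNIV] ext by (simp add: finite_field_extension_def)
  then show "card (sub_combs \<iota> n v) \<le> q ^ m"
    by (metis card_mono finite subset_UNIV)
qed

lemma rank_weight_scale_le: "rank_weight \<iota> n (ext_vscale c v) \<le> rank_weight \<iota> n v"
proof (rule rank_weight_leI)
  have "sub_combs \<iota> n (ext_vscale c v) \<subseteq> (*) c ` sub_combs \<iota> n v"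
  proof
    fix x assume "x \<in> sub_combs \<iota> n (ext_vscale c v)"
    then obtain d where "x = (\<Sum>j<n. \<iota> (d j) * ext_vscale c v j)" by (rule sub_combsE)
    then have "x = c * (\<Sum>j<n. \<iota> (d j) * v j)"
      by (simp add: ext_vscale_def sum_distrib_left mult.left_commute)
    then show "x \<in> (*) c ` sub_combs \<iota> n v" using sub_combsI by blast
  qed
  then show "card (sub_combs \<iota> n (ext_vscale c v)) \<le> q ^ rank_weight \<iota> n v"
    unfolding card_sub_combs[symmetric] by (intro surj_card_le) auto
qed

text \<open>With the coefficients kept fixed, a combination of the entries of \<open>u + v\<close>
  splits into one for \<open>u\<close> and one for \<open>v\<close>, so the number of pairs is an
  upper bound.\<close>

lemma rank_weight_add_le:
  "rank_weight \<iota> n (u + v) \<le> rank_weight \<iota> n u + rank_weight \<iota> n v"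
proof (rule rank_weight_leI)
  have "sub_combs \<iota> n (u + v) \<subseteq> (\<lambda>(x, y). x + y) ` (sub_combs \<iota> n u \<times> sub_combs \<iota> n v)"
  proof
    fix x assume "x \<in> sub_combs \<iota> n (u + v)"
    then obtain d where "x = (\<Sum>j<n. \<iota> (d j) * (u + v) j)" by (rule sub_combsE)
    then have "x = (\<Sum>j<n. \<iota> (d j) * u j) + (\<Sum>j<n. \<iota> (d j) * v j)"
      by (simp add: distrib_left sum.distrib)
    then show "x \<in> (\<lambda>(x, y). x + y) ` (sub_combs \<iota> n u \<times> sub_combs \<iota> n v)"
      by (simp add: image_iff) (metis sub_combsI)
  qed
  then have "card (sub_combs \<iota> n (u + v)) \<le> card (sub_combs \<iota> n u \<times> sub_combs \<iota> n v)"
    by (intro surj_card_le) auto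
  then show "card (sub_combs \<iota> n (u + v)) \<le> q ^ (rank_weight \<iota> n u + rank_weight \<iota> n v)"
    by (simp add: card_cartesian_product card_sub_combs power_add)
qed

lemma rank_weight_zero: "rank_weight \<iota> n 0 = 0"
proof -
  have "sub_combs \<iota> n (0 :: nat \<Rightarrow> 'e) \<subseteq> {0}" by (auto elim!: sub_combsE)
  then have "card (sub_combs \<iota> n (0 :: nat \<Rightarrow> 'e)) \<le> q ^ 0"
    by (metis card_mono card_1_singleton_iff finite power_0 One_nat_def)
  then show ?thesis using rank_weight_leI by blast
qed

lemma rank_weight_pos:
  assumes "i < n" "v i \<noteq> 0"
  shows "0 < rank_weight \<iota> n v"
proof -
  have "(\<Sum>j<n. \<iota> (if j = i then 1 else 0) * v j) = (\<Sum>j<n. if j = i then v j else 0)"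
    by (intro sum.cong) (auto simp: embed_0 embed_1)
  also have "\<dots> = v i" using assms by simp
  finally have "v i \<in> sub_combs \<iota> n v"
    using sub_combsI[of \<iota> "\<lambda>j. if j = i then 1 else 0" v n] by simp
  moreover have "0 \<in> sub_combs \<iota> n v"
    using sub_combsI[of \<iota> "\<lambda>_. 0" v n] by (simp add: embed_0)
  ultimately have "card {0, v i} \<le> card (sub_combs \<iota> n v)" by (intro card_mono) auto
  then have "2 \<le> q ^ rank_weight \<iota> n v" using assms by (simp add: card_sub_combs)
  then show ?thesis by (cases "rank_weight \<iota> n v") auto
qed

section \<open>Weights of words spanning a code\<close>

lemma rank_weight_in_span:
  fixes v :: "nat \<Rightarrow> nat \<Rightarrow> 'e"
  assumes "c \<in> extv.span (v ` {..<i})"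
  shows "rank_weight \<iota> n c \<le> (\<Sum>j<i. rank_weight \<iota> n (v j))"
  using assms
proof (induction i arbitrary: c)
  case 0
  then have "c = 0" by simp
  then show ?case by (simp only: rank_weight_zero)
next
  case (Suc i)
  then obtain d where d: "c - ext_vscale d (v i) \<in> extv.span (v ` {..<i})"
    by (auto simp: lessThan_Suc extv.span_breakdown_eq)
  have "rank_weight \<iota> n c \<le> rank_weight \<iota> n (c - ext_vscale d (v i)) + rank_weight \<iota> n (ext_vscale d (v i))"
    using rank_weight_add_le[of n "c - ext_vscale d (v i)" "ext_vscale d (v i)"] by simp
  also have "\<dots> \<le> (\<Sum>j<i. rank_weight \<iota> n (v j)) + rank_weight \<iota> n (v i)"
    using Suc.IH[OF d] rank_weight_scale_le by (intro add_mono)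
  finally show ?case by simp
qed

text \<open>The pairings of a base-field tuple \<open>c\<close> with the words \<open>v i\<close>
  determine its pairings with all codewords, in particular with the rows of \<open>G\<close>, hence
  the combination of the columns with coefficients \<open>c\<close>; nondegeneracy recovers
  \<open>c\<close>. Counting tuples and possible pairings gives the bound.\<close>

lemma length_le_sum_rank_weights:
  assumes nd: "nondegenerate \<iota> n k C" and C: "C \<subseteq> extv.span (v ` {..<k})"
  shows "n \<le> (\<Sum>i<k. rank_weight \<iota> n (v i))"
proof -
  obtain G where G: "\<And>i j. k \<le> i \<or> n \<le> j \<Longrightarrow> G i j = 0" "extv.span (G ` {..<k}) = C"
    and dim: "subv.dim (subv.span ((\<lambda>j i. G i j) ` {..<n})) = n"
    using nd unfolding nondegenerate_def generator_matrix_def by blast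
  let ?X = "{..<n} \<rightarrow>\<^sub>E (UNIV :: 'f set)"
  let ?col = "\<lambda>c. \<Sum>j<n. sub_vscale \<iota> (c j) (\<lambda>i. G i j)"
  have cardX: "card ?X = q ^ n" by (simp add: card_PiE base_card)
  have finX: "finite ?X" by (intro finite_PiE) auto
  have "subv.dim ((\<lambda>j i. G i j) ` {..<n}) = n" using dim by (simp only: subv.dim_span)
  then have "card (?col ` ?X) = q ^ n"
    using subv.card_span[of "(\<lambda>j i. G i j) ` {..<n}"]
    by (simp add: subv.span_image_eq_sums base_card)
  \<comment> \<open>The column span has as many elements as there are coefficient tuples.\<close>
  then have inj: "inj_on ?col ?X"
    using finX cardX by (intro eq_card_imp_inj_on) auto
  let ?\<Phi> = "\<lambda>c. \<lambda>i\<in>{..<k}. \<Sum>j<n. \<iota> (c j) * v i j"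
  have "inj_on ?\<Phi> ?X"
  proof (rule inj_onI)
    fix c d assume cd: "c \<in> ?X" "d \<in> ?X" and eq: "?\<Phi> c = ?\<Phi> d"
    \<comment> \<open>The pairing is linear in \<open>x\<close> over the extension field, so
      \<open>?Z\<close> absorbs the whole extension-field span of the \<open>v i\<close>.\<close>
    let ?Z = "{x. (\<Sum>j<n. \<iota> (c j) * x j) = (\<Sum>j<n. \<iota> (d j) * x j)}"
    have *: "(\<Sum>j<n. f j * (b * x j)) = b * (\<Sum>j<n. f j * x j)" for f x :: "nat \<Rightarrow> 'e" and b
      by (simp add: sum_distrib_left mult.left_commute)
    have "extv.subspace ?Z"
      unfolding extv.subspace_def by (auto simp: ext_vscale_def distrib_left sum.distrib *)
    moreover have "v i \<in> ?Z" if "i < k" for i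
      using fun_cong[OF eq, of i] that by simp
    then have "v ` {..<k} \<subseteq> ?Z" by blast
    ultimately have "C \<subseteq> ?Z" using C extv.span_minimal by blast
    moreover have "G i \<in> C" if "i < k" for i
      using G(2) that by (auto intro: extv.span_base)
    ultimately have "(\<Sum>j<n. \<iota> (c j) * G i j) = (\<Sum>j<n. \<iota> (d j) * G i j)" for i
      using G(1)[of i] by (cases "i < k") auto
    moreover have "?col e i = (\<Sum>j<n. \<iota> (e j) * G i j)" for e i
      by (induction n) (simp_all add: sub_vscale_def)
    ultimately have "?col c = ?col d" by (simp add: fun_eq_iff)
    then show "c = d" using inj cd by (auto dest: inj_onD)
  qed
  moreover have "?\<Phi> ` ?X \<subseteq> (\<Pi>\<^sub>E i\<in>{..<k}. sub_combs \<iota> n (v i))"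
    by (intro image_subsetI PiE_I) (simp_all add: sub_combsI)
  ultimately have "card ?X \<le> card (\<Pi>\<^sub>E i\<in>{..<k}. sub_combs \<iota> n (v i))"
    by (rule card_inj_on_le) (simp add: finite_PiE)
  also have "\<dots> = q ^ (\<Sum>i<k. rank_weight \<iota> n (v i))"
    by (simp add: card_PiE card_sub_combs power_sum)
  finally show ?thesis using one_less_q cardX by simp
qed

text \<open>Fewer than \<open>k\<close> words cannot span \<open>C\<close>, so a codeword of least
  weight outside their span exists. The \<open>k\<close> words chosen this way are independent and
  hence span \<open>C\<close>.\<close>

lemma greedy_basis:
  assumes "is_code n k C"
  obtains v where
    "\<And>i. i < k \<Longrightarrow> v i \<in> C"
    "\<And>i c. i < k \<Longrightarrow> c \<in> C \<Longrightarrow> c \<notin> extv.span (v ` {..<i}) \<Longrightarrow> rank_weight \<iota> n (v i) \<le> rank_weight \<iota> n c"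
    "C \<subseteq> extv.span (v ` {..<k})"
proof -
  have dim: "extv.dim C = k" and zero: "\<And>x i. x \<in> C \<Longrightarrow> n \<le> i \<Longrightarrow> x i = 0"
    using assms by (auto simp: is_code_def)
  \<comment> \<open>The guard \<open>i < k\<close> makes \<open>P\<close> satisfiable at every
    index, as a choice over all of \<open>nat\<close> demands.\<close>
  define P where "P v i r \<longleftrightarrow> i < k \<longrightarrow> r \<in> C \<and> r \<notin> extv.span (v ` {..<i}) \<and>
      (\<forall>c. c \<in> C \<and> c \<notin> extv.span (v ` {..<i}) \<longrightarrow> rank_weight \<iota> n r \<le> rank_weight \<iota> n c)" for v i r
  have "\<exists>v. \<forall>i. P v i (v i)"
  proof (rule dependent_wellorder_choice)
    fix r i and f g :: "nat \<Rightarrow> nat \<Rightarrow> 'e"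
    assume "\<And>y. y < i \<Longrightarrow> f y = g y"
    then have "f ` {..<i} = g ` {..<i}" by auto
    then show "P f i r = P g i r" by (simp add: P_def)
  next
    fix i v
    show "\<exists>r. P v i r"
    proof (cases "i < k")
      case True
      have "\<not> C \<subseteq> extv.span (v ` {..<i})"
      proof
        assume "C \<subseteq> extv.span (v ` {..<i})"
        then have "k \<le> card (v ` {..<i})" using dim extv.dim_le_card by blast
        also have "\<dots> \<le> i" using card_image_le[of "{..<i}" v] by simp
        finally show False using True by simp
      qed
      then obtain c where "c \<in> C \<and> c \<notin> extv.span (v ` {..<i})" by blast
      from ex_has_least_nat[of "\<lambda>c. c \<in> C \<and> c \<notin> extv.span (v ` {..<i})", OF this]
      show ?thesis unfolding P_def by blast
    qed (simp add: P_def)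
  qed
  then obtain v where v: "\<And>i. P v i (v i)" by blast
  have "i \<le> k \<Longrightarrow> extv.independent (v ` {..<i}) \<and> card (v ` {..<i}) = i" for i
  proof (induction i)
    case (Suc i)
    then have "v i \<notin> extv.span (v ` {..<i})" using v[of i] by (simp add: P_def)
    moreover from this have "v i \<notin> v ` {..<i}" by (metis extv.span_base)
    ultimately show ?case
      using Suc by (simp add: lessThan_Suc extv.independent_insertI)
  qed (simp add: extv.independent_empty)
  then have ind: "extv.independent (v ` {..<k})" "card (v ` {..<k}) = k" by auto
  \<comment> \<open>Finiteness of \<open>C\<close> comes from its words vanishing from
    \<open>n\<close> on; the ambient function type is infinite.\<close>
  have "C \<subseteq> (\<lambda>f i. if i < n then f i else 0) ` ({..<n} \<rightarrow>\<^sub>E UNIV)"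
  proof
    fix x assume "x \<in> C"
    then have "x = (\<lambda>f i. if i < n then f i else 0) (restrict x {..<n})"
      using zero by (auto simp: fun_eq_iff not_less)
    then show "x \<in> (\<lambda>f i. if i < n then f i else 0) ` ({..<n} \<rightarrow>\<^sub>E UNIV)"
      by (rule image_eqI[where x = "restrict x {..<n}"]) simp
  qed
  moreover have "finite ({..<n} \<rightarrow>\<^sub>E (UNIV :: 'e set))" by (intro finite_PiE) auto
  ultimately have "finite C" by (meson finite_imageI finite_subset)
  then have "C \<subseteq> extv.span (v ` {..<k})"
    using v ind dim by (intro extv.basis_if_card_eq_dim) (auto simp: P_def)
  then show ?thesis using v by (intro that) (auto simp: P_def)
qed

end

section \<open>Counting the values lost to gaps\<close>

lemma card_avoiding_gaps:
  fixes w :: "nat \<Rightarrow> nat" and W :: "nat set"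
  defines "S \<equiv> \<lambda>i. \<Sum>j<i. w j"
  assumes W: "W \<subseteq> {1..m}" and w: "\<And>i. i \<le> d \<Longrightarrow> w i \<le> m"
    and gap: "\<And>i u. i \<le> d \<Longrightarrow> S i < u \<Longrightarrow> u < w i \<Longrightarrow> u \<notin> W"
  obtains M where "card W + M \<le> m" "S (Suc d) + 1 \<le> 2 ^ d * (M + 2)"
proof -
  \<comment> \<open>The union of the first \<open>i\<close> gaps; the one for \<open>j = 0\<close>
    consists of the positive values below \<open>w 0\<close>. The size of \<open>D (Suc d)\<close>
    serves as \<open>M\<close>.\<close>
  define D where "D i = (\<Union>j<i. {S j<..<w j})" for i
  have S_Suc: "S (Suc i) = S i + w i" for i by (simp add: S_def)
  have S_mono: "S i \<le> S j" if "i \<le> j" for i j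
    unfolding S_def using that by (intro sum_mono2) auto
  \<comment> \<open>Earlier gaps lie below some \<open>w j \<le> S (Suc j) \<le> S i\<close>, the
    new one lies above \<open>S i\<close>. Truncated subtraction correctly yields 0 for an empty
    gap.\<close>
  have D_Suc: "card (D (Suc i)) = card (D i) + (w i - S i - 1)" for i
  proof -
    have "D i \<subseteq> {..S i}"
    proof
      fix u assume "u \<in> D i"
      then obtain j where "j < i" "u < w j" by (auto simp: D_def)
      then show "u \<in> {..S i}" using S_mono[of "Suc j" i] S_Suc[of j] by simp
    qed
    moreover have D_eq: "D (Suc i) = D i \<union> {S i<..<w i}" by (auto simp: D_def lessThan_Suc)
    moreover have "finite (D i)" by (simp add: D_def)
    ultimately show ?thesis by (subst D_eq, subst card_Un_disjoint) auto
  qed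
  \<comment> \<open>Each \<open>w i\<close> is at most \<open>S i + 1\<close> plus the size of its
    gap. Adding 1 to the sums absorbs the constant, leaving a doubling plus the gap size.\<close>
  have bound: "S (Suc i) + 1 \<le> 2 ^ i * (card (D (Suc i)) + 2)" for i
  proof (induction i)
    case 0
    show ?case using D_Suc[of 0] by (simp add: S_def D_def)
  next
    case (Suc i)
    let ?g = "w (Suc i) - S (Suc i) - 1"
    have "S (Suc (Suc i)) + 1 \<le> 2 * (S (Suc i) + 1) + ?g" by (simp add: S_Suc[of "Suc i"])
    \<comment> \<open>The gap size is inflated by \<open>2 ^ Suc i\<close> only to share the common
      factor.\<close>
    also have "\<dots> \<le> 2 * (2 ^ i * (card (D (Suc i)) + 2)) + 2 ^ Suc i * ?g"
      using Suc.IH by (intro add_mono mult_le_mono2) simp_all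
    also have "\<dots> = 2 ^ Suc i * (card (D (Suc (Suc i))) + 2)"
      by (simp add: D_Suc[of "Suc i"] algebra_simps)
    finally show ?case .
  qed
  have "D (Suc d) \<subseteq> {1..m}"
  proof
    fix u assume "u \<in> D (Suc d)"
    then obtain j where "j \<le> d" "S j < u" "u < w j" by (auto simp: D_def less_Suc_eq_le)
    then show "u \<in> {1..m}" using w[of j] by simp
  qed
  moreover have "W \<inter> D (Suc d) = {}" using gap by (auto simp: D_def less_Suc_eq_le)
  ultimately have "card W + card (D (Suc d)) = card (W \<union> D (Suc d))" "W \<union> D (Suc d) \<subseteq> {1..m}"
    using W by (auto intro!: card_Un_disjoint[symmetric] intro: finite_subset)
  then have "card W + card (D (Suc d)) \<le> m"
    using card_mono[of "{1..m}" "W \<union> D (Suc d)"] by simp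
  then show ?thesis using bound that by blast
qed

text \<open>The last \<open>k - Suc d\<close> greedy words weigh at most \<open>m\<close> each, so
  the first \<open>Suc d\<close> must carry the rest of \<open>n\<close>. A large total there forces
  many values to be lost to gaps.\<close>

lemma card_weight_set_le:
  fixes \<iota> :: "'f::{field,finite} \<Rightarrow> 'e::{field,finite}"
  assumes ext: "finite_field_extension \<iota> q m"
    and C: "is_code n k C" and nd: "nondegenerate \<iota> n k C" and d: "d < k"
  shows "card (weight_set \<iota> n C) \<le> m - max ((n - (k - Suc d) * m) div 2 ^ d) 1 + 1"
proof -
  let ?span = "module.span (ext_vscale :: 'e \<Rightarrow> _)"
  obtain v where v: "\<And>i. i < k \<Longrightarrow> v i \<in> C"
    "\<And>i c. i < k \<Longrightarrow> c \<in> C \<Longrightarrow> c \<notin> ?span (v ` {..<i}) \<Longrightarrow> rank_weight \<iota> n (v i) \<le> rank_weight \<iota> n c"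
    "C \<subseteq> ?span (v ` {..<k})"
    using greedy_basis[OF ext C] by blast
  define w where "w i = rank_weight \<iota> n (v i)" for i
  have w_le: "w i \<le> m" for i unfolding w_def by (rule rank_weight_le_degree[OF ext])
  have pos: "0 < rank_weight \<iota> n c" if "c \<in> C - {0}" for c
  proof -
    from that obtain i where "c i \<noteq> 0" by (auto simp: fun_eq_iff)
    moreover from this have "i < n" using that C by (auto simp: is_code_def not_less[symmetric])
    ultimately show ?thesis by (intro rank_weight_pos[OF ext])
  qed
  have W: "weight_set \<iota> n C \<subseteq> {1..m}"
    using pos rank_weight_le_degree[OF ext] by (force simp: weight_set_def Suc_le_eq)
  have gap: "u \<notin> weight_set \<iota> n C" if "i \<le> d" "(\<Sum>j<i. w j) < u" "u < w i" for i u
  proof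
    assume "u \<in> weight_set \<iota> n C"
    then obtain c where c: "c \<in> C" "u = rank_weight \<iota> n c" by (auto simp: weight_set_def)
    show False
    proof (cases "c \<in> ?span (v ` {..<i})")
      case True
      then show False using rank_weight_in_span[OF ext, of c v i n] that c by (simp add: w_def)
    next
      case False
      then show False using v(2)[of i c] that c d by (simp add: w_def)
    qed
  qed
  obtain M where M: "card (weight_set \<iota> n C) + M \<le> m" "(\<Sum>j<Suc d. w j) + 1 \<le> 2 ^ d * (M + 2)"
    by (rule card_avoiding_gaps[of "weight_set \<iota> n C" m d w]) (use W w_le gap in blast)+
  have "n \<le> (\<Sum>j<k. w j)"
    unfolding w_def by (rule length_le_sum_rank_weights[OF ext nd v(3)])
  also have "\<dots> = (\<Sum>j<Suc d. w j) + (\<Sum>j=Suc d..<k. w j)"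
    using d by (simp only: lessThan_atLeast0 sum.atLeastLessThan_concat)
  also have "(\<Sum>j=Suc d..<k. w j) \<le> (k - Suc d) * m"
    using sum_bounded_above[of "{Suc d..<k}" w m] w_le by simp
  finally have "n - (k - Suc d) * m < 2 ^ d * (M + 2)" using M(2) by simp
  then have "(n - (k - Suc d) * m) div 2 ^ d < M + 2"
    by (simp add: less_mult_imp_div_less mult.commute)
  \<comment> \<open>The quotient is at most \<open>M + 1\<close>, and so is its maximum with
    1.\<close>
  then show ?thesis using M(1) by simp
qed

theorem theorem4p12:
  fixes \<iota> :: "'f::{field,finite} \<Rightarrow> 'e::{field,finite}"
    and q n m k t a h :: nat
  assumes "primepow q"
    and "finite_field_extension \<iota> q m"
    and "0 < n" and "0 < m" and "0 < k"
    and "m < n" and "n \<le> k * m"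
    and "t = (k * m - n) div m"
    and "a = n - (k - t - 2) * m"
    and "h = max (a div 2 ^ (t + 1)) 1"
  shows "L_rk \<iota> n k \<le> m - h + 1"
proof -
  have "t * m \<le> k * m - n"
    using assms(8) by simp
  \<comment> \<open>Here \<open>m < n\<close> enters. It makes \<open>d = t + 1\<close> admissible,
    and then \<open>k - Suc d\<close> is \<open>k - t - 2\<close>, as in the definition of
    \<open>a\<close>.\<close>
  then have "(t + 1) * m < k * m" using assms(6,7) by simp
  then have t: "t + 1 < k" using mult_less_cancel2 by blast
  have "card (weight_set \<iota> n C) \<le> m - h + 1" if "is_code n k C" "nondegenerate \<iota> n k C" for C
    using card_weight_set_le[OF assms(2) that t] assms(9,10) by simp
  then have "\<forall>x \<in> {card (weight_set \<iota> n C) | C. is_code n k C \<and> nondegenerate \<iota> n k C}. x \<le> m - h + 1"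
    by blast
  then show ?thesis
    unfolding L_rk_def
    \<comment> \<open>If no nondegenerate code exists, the supremum is 0 and the bound is
      trivial.\<close>
    by (cases "{card (weight_set \<iota> n C) | C. is_code n k C \<and> nondegenerate \<iota> n k C} = {}")
      (simp_all only: Sup_nat_empty, auto intro!: cSup_least)
qed

end
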